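(* Let $Z \subset A^{\mathbb{Z}}$ be a two-sided subshift over a finite alphabet $A$ such that every periodic point $s \in Z$ is synchronizing and neither $Z_{-\mathbb{N}}$ nor $Z_{\mathbb{N}}$ has an isolated periodic point, and let $X = Z_{\mathbb{N}}$. Let $Y \subset B^{\mathbb{N}}$ be a one-sided subshift over a finite alphabet $B$, and let $X' \subset X$, $Y' \subset Y$ be the subsets of non-periodic points. Then for every shift-commuting continuous function $\phi' : X' \to Y'$ there exists a shift-commuting continuous function $\phi : X \to Y$ such that $\phi'$ is the domain-codomain restriction of $\phi$ (i.e. $\phi(x) = \phi'(x)$ for all $x \in X'$), and this $\phi$ is unique.
   Context: For a finite alphabet $A$, the spaces $A^{\mathbb{Z}}, A^{\mathbb{N}}, A^{-\mathbb{N}}$ carry the product topology of the discrete topology; here $0 \in \mathbb{N}$ and $-\mathbb{N} = \{0,-1,-2,\ldots\}$. The shift on $A^{\mathbb{Z}}$ and on $A^{\mathbb{N}}$ is $\sigma(x)_i = x_{i+1}$. A two-sided subshift is a closed set $Z \subset A^{\mathbb{Z}}$ with $\sigma(Z) = Z$; a one-sided subshift is a closed set $Y \subset B^{\mathbb{N}}$ with $\sigma(Y) = Y$ (equivalently, $Y = W_{\mathbb{N}}$ for a two-sided subshift $W$, in the notation below). For a two-sided subshift $Z$, $Z_{\mathbb{N}} = \{y \in A^{\mathbb{N}} \mid \exists x \in Z: \forall i \in \mathbb{N}: y_i = x_i\}$ and $Z_{-\mathbb{N}} = \{y \in A^{-\mathbb{N}} \mid \exists x \in Z: \forall i \in -\mathbb{N}: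 y_i = x_i\}$. A point $x$ of $A^{\mathbb{Z}}$ or $A^{\mathbb{N}}$ is periodic if $\sigma^n(x) = x$ for some $n > 0$; a point $x \in A^{-\mathbb{N}}$ is periodic if for some $n > 0$ we have $x_{i-n} = x_i$ for all $i \le 0$. A point is aperiodic if it is not periodic. A point is isolated if it is topologically isolated in the given space ($Z_{\mathbb{N}}$ or $Z_{-\mathbb{N}}$). A word $w$ occurring in some point of $Z$ is synchronizing (for $Z$) if whenever $x, y \in Z$ and $x_{[\ell,\ell']} = w = y_{[\ell,\ell']}$, the point $z$ defined by $z_i = x_i$ for $i \le \ell'$ and $z_i = y_i$ for $i > \ell'$ is also in $Z$. A point of $Z$ is synchronizing if some synchronizing word occurs in it. For a one-sided subshift $X$, $X' = \{x \in X \mid x \text{ is aperiodic}\}$ with the subspace topology. In general $\sigma(X') \not\subset X'$, so $\sigma$ acts only partially on $X'$. A function $\phi' : X' \to Y'$ is shift-commuting if for all $x \in X'$ with $\sigma(x) \in X'$ we have $\sigma(\phi'(x)) = \phi'(\sigma(x))$ (in particular $\sigma(\phi'(x))$ is then aperiodic). A function $\phi : X \to Y$ is shift-commuting if $\sigma(\phi(x)) = \phi(\sigma(x))$ for all $x \in X$. *)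

theory Defs
  imports "HOL-Analysis.Analysis"
begin

text \<open>
  Points are functions on an index set: \<open>UNIV :: int set\<close> for two-sided, \<open>UNIV :: nat set\<close>
  for right-infinite, and \<open>{..0::int}\<close> for left-infinite sequences. The last are
  extensional (\<open>undefined\<close> at positive indices), as required by \<^const>\<open>product_topology\<close>.
\<close>

definition full_shift :: "'a set \<Rightarrow> 'i set \<Rightarrow> ('i \<Rightarrow> 'a) topology" where
  "full_shift A I = product_topology (\<lambda>_. discrete_topology A) I"

definition shift :: "('i::{plus,one} \<Rightarrow> 'a) \<Rightarrow> 'i \<Rightarrow> 'a" where
  "shift x = (\<lambda>i. x (i + 1))"

text \<open>Two-sided for \<open>'i = int\<close>, one-sided for \<open>'i = nat\<close>; the empty subshift is allowed.\<close>

definition subshift :: "'a set \<Rightarrow> ('i::{plus,one} \<Rightarrow> 'a) set \<Rightarrow> bool" where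
  "subshift A Z \<longleftrightarrow> closedin (full_shift A UNIV) Z \<and> shift ` Z = Z"

definition right_part :: "(int \<Rightarrow> 'a) set \<Rightarrow> (nat \<Rightarrow> 'a) set" where
  "right_part Z = {y. \<exists>x\<in>Z. \<forall>i. y i = x (int i)}"

definition left_part :: "(int \<Rightarrow> 'a) set \<Rightarrow> (int \<Rightarrow> 'a) set" where
  "left_part Z = {y \<in> extensional {..0}. \<exists>x\<in>Z. \<forall>i\<in>{..0}. y i = x i}"

definition periodic :: "('i::{plus,one} \<Rightarrow> 'a) \<Rightarrow> bool" where
  "periodic x \<longleftrightarrow> (\<exists>n>0. (shift ^^ n) x = x)"

text \<open>Periodicity of a left-infinite point, which looks only at indices \<open>i \<le> 0\<close>.\<close>

definition left_periodic :: "(int \<Rightarrow> 'a) \<Rightarrow> bool" where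
  "left_periodic x \<longleftrightarrow> (\<exists>n>0. \<forall>i\<le>0. x (i - int n) = x i)"

definition isolated_point :: "'b topology \<Rightarrow> 'b set \<Rightarrow> 'b \<Rightarrow> bool" where
  "isolated_point T S x \<longleftrightarrow> openin (subtopology T S) {x}"

definition subword :: "(int \<Rightarrow> 'a) \<Rightarrow> int \<Rightarrow> int \<Rightarrow> 'a list" where
  "subword x l l' = map x [l..l']"

definition occurs_in :: "'a list \<Rightarrow> (int \<Rightarrow> 'a) \<Rightarrow> bool" where
  "occurs_in w x \<longleftrightarrow> (\<exists>l l'. subword x l l' = w)"

definition synchronizing_word :: "(int \<Rightarrow> 'a) set \<Rightarrow> 'a list \<Rightarrow> bool" where
  "synchronizing_word Z w \<longleftrightarrow>
    (\<exists>x\<in>Z. occurs_in w x) \<and>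
    (\<forall>x\<in>Z. \<forall>y\<in>Z. \<forall>l l'. subword x l l' = w \<and> subword y l l' = w \<longrightarrow>
      (\<lambda>i. if i \<le> l' then x i else y i) \<in> Z)"

definition synchronizing_point :: "(int \<Rightarrow> 'a) set \<Rightarrow> (int \<Rightarrow> 'a) \<Rightarrow> bool" where
  "synchronizing_point Z x \<longleftrightarrow> x \<in> Z \<and> (\<exists>w. synchronizing_word Z w \<and> occurs_in w x)"

definition aperiodic_part :: "(nat \<Rightarrow> 'a) set \<Rightarrow> (nat \<Rightarrow> 'a) set" where
  "aperiodic_part X = {x \<in> X. \<not> periodic x}"

text \<open>On \<open>S = aperiodic_part X\<close> the shift acts only partially, hence the guard;
  it is vacuous when \<open>shift ` S \<subseteq> S\<close>, in particular when \<open>S\<close> is a subshift.\<close>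

definition shift_commuting_on :: "(nat \<Rightarrow> 'a) set \<Rightarrow> ((nat \<Rightarrow> 'a) \<Rightarrow> (nat \<Rightarrow> 'b)) \<Rightarrow> bool" where
  "shift_commuting_on S f \<longleftrightarrow> (\<forall>x\<in>S. shift x \<in> S \<longrightarrow> shift (f x) = f (shift x))"

end

theory Submission
  imports Defs
begin

text \<open>
  A periodic \<open>x \<in> X\<close> extends to a periodic point of \<open>Z\<close>, so points agreeing with \<open>x\<close> on a long
  window can be spliced there. As the left-infinite extension of \<open>x\<close> is not isolated, splicing
  yields an aperiodic \<open>p = v x \<in> X\<close> with \<open>v\<close> a finite word, and \<open>\<phi> x\<close> must be the tail
  of \<open>\<phi>' p\<close> after \<open>v\<close>. An aperiodic \<open>y\<close> close to \<open>x\<close> can also be preceded by \<open>v\<close>, and continuity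
  of \<open>\<phi>'\<close> at \<open>p\<close> then shows that \<open>\<phi>' y\<close> is close to this tail. As \<open>x\<close> itself is not isolated, splicing
  also shows that the points with aperiodic \<open>n\<close>-th shift are dense in \<open>X\<close>, so continuity,
  equivariance and uniqueness pass to all of \<open>X\<close>.
\<close>

section \<open>Cylinders\<close>

lemma topspace_full_shift [simp]: "topspace (full_shift A I) = (\<Pi>\<^sub>E i\<in>I. A)"
  by (simp add: full_shift_def)

lemma openin_cylinder:
  assumes "finite F" "F \<subseteq> I" "S \<subseteq> topspace (full_shift A I)"
  shows "openin (subtopology (full_shift A I) S) {y \<in> S. \<forall>i\<in>F. y i = x i}"
proof -
  have "openin (full_shift A I) (\<Pi>\<^sub>E i\<in>I. if i \<in> F then A \<inter> {x i} else A)"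
    unfolding full_shift_def openin_PiE_gen using assms(1)
    by (auto intro: finite_subset)
  moreover have "{y \<in> S. \<forall>i\<in>F. y i = x i} = (\<Pi>\<^sub>E i\<in>I. if i \<in> F then A \<inter> {x i} else A) \<inter> S"
  proof (intro set_eqI iffI)
    fix y assume y: "y \<in> {y \<in> S. \<forall>i\<in>F. y i = x i}"
    then have "y \<in> (\<Pi>\<^sub>E i\<in>I. A)"
      using assms(3) by auto
    then have "y i \<in> (if i \<in> F then A \<inter> {x i} else A)" if "i \<in> I" for i
      using y that by (cases "i \<in> F") force+
    with \<open>y \<in> (\<Pi>\<^sub>E i\<in>I. A)\<close> y show "y \<in> (\<Pi>\<^sub>E i\<in>I. if i \<in> F then A \<inter> {x i} else A) \<inter> S"
      by (simp add: PiE_iff)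
  next
    fix y assume "y \<in> (\<Pi>\<^sub>E i\<in>I. if i \<in> F then A \<inter> {x i} else A) \<inter> S"
    then have "y \<in> S" "\<And>i. i \<in> I \<Longrightarrow> y i \<in> (if i \<in> F then A \<inter> {x i} else A)"
      by (simp_all add: PiE_iff)
    with assms(2) show "y \<in> {y \<in> S. \<forall>i\<in>F. y i = x i}"
      by fastforce
  qed
  ultimately show ?thesis
    by (auto simp: openin_subtopology)
qed

text \<open>A basic open box restricts only finitely many coordinates, so agreeing with
  \<open>x\<close> on those is enough to stay inside it.\<close>

lemma cylinder_in_open:
  assumes "openin (subtopology (full_shift A I) S) U" "x \<in> U"
  obtains F where "finite F" "F \<subseteq> I" "\<And>y. y \<in> S \<Longrightarrow> y \<in> topspace (full_shift A I) \<Longrightarrow> \<forall>i\<in>F. y i = x i \<Longrightarrow> y \<in> U"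
proof -
  obtain V where V: "openin (full_shift A I) V" "U = V \<inter> S"
    using assms(1) by (auto simp: openin_subtopology)
  then obtain W where W: "finite {i \<in> I. W i \<noteq> topspace (discrete_topology A)}"
      "\<forall>i\<in>I. openin (discrete_topology A) (W i)" "x \<in> Pi\<^sub>E I W" "Pi\<^sub>E I W \<subseteq> V"
    using assms(2) unfolding full_shift_def openin_product_topology_alt by fastforce
  show thesis
  proof (rule that[of "{i \<in> I. W i \<noteq> A}"])
    fix y assume "y \<in> S" "y \<in> topspace (full_shift A I)" "\<forall>i\<in>{i \<in> I. W i \<noteq> A}. y i = x i"
    then have "y \<in> Pi\<^sub>E I W"
      using W(3) by (auto simp: PiE_iff)
    with \<open>y \<in> S\<close> V(2) W(4) show "y \<in> U" by auto
  qed (use W(1) in auto)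
qed

lemma not_isolated_point_imp:
  assumes "\<not> isolated_point (full_shift A I) S x" "x \<in> S" "S \<subseteq> topspace (full_shift A I)"
    and "finite F" "F \<subseteq> I"
  obtains y where "y \<in> S" "y \<noteq> x" "\<forall>i\<in>F. y i = x i"
proof -
  have "{y \<in> S. \<forall>i\<in>F. y i = x i} \<noteq> {x}"
    using openin_cylinder[OF assms(4,5,3), of x] assms(1) by (auto simp: isolated_point_def)
  with assms(2) that show thesis by blast
qed

text \<open>If \<open>x\<close> were outside \<open>Z\<close>, some cylinder around it would miss
  the closed set \<open>Z\<close>. This reduces membership in \<open>Z\<close> to finite
  windows.\<close>

lemma closedin_full_shiftD:
  assumes "closedin (full_shift A I) Z" "x \<in> topspace (full_shift A I)"
    and "\<And>F. finite F \<Longrightarrow> F \<subseteq> I \<Longrightarrow> \<exists>z\<in>Z. \<forall>i\<in>F. z i = x i"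
  shows "x \<in> Z"
proof (rule ccontr)
  assume "x \<notin> Z"
  let ?U = "topspace (full_shift A I) - Z"
  have "openin (subtopology (full_shift A I) (topspace (full_shift A I))) ?U"
    using assms(1) by (simp add: closedin_def subtopology_topspace del: topspace_full_shift)
  then obtain F where F: "finite F" "F \<subseteq> I" "\<And>y. y \<in> topspace (full_shift A I) \<Longrightarrow> \<forall>i\<in>F. y i = x i \<Longrightarrow> y \<in> ?U"
    using \<open>x \<notin> Z\<close> assms(2) by (elim cylinder_in_open[where x = x]) auto
  then obtain z where "z \<in> Z" "\<forall>i\<in>F. z i = x i"
    using assms(3) by blast
  with F(3)[of z] closedin_subset[OF assms(1)] show False by blast
qed

text \<open>Every finite set of natural numbers lies in an initial segment, so prefixes of
  \<open>x\<close> give a neighbourhood base. Later continuity arguments only compare prefixes, one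
  output coordinate at a time.\<close>

lemma continuous_map_full_shift_iff:
  fixes f :: "(nat \<Rightarrow> 'a) \<Rightarrow> 'j \<Rightarrow> 'b"
  assumes "S \<subseteq> topspace (full_shift A UNIV)" "T \<subseteq> topspace (full_shift B UNIV)"
  shows "continuous_map (subtopology (full_shift A UNIV) S) (subtopology (full_shift B UNIV) T) f \<longleftrightarrow>
    f ` S \<subseteq> T \<and> (\<forall>x\<in>S. \<forall>i. \<exists>n. \<forall>y\<in>S. (\<forall>j<n. y j = x j) \<longrightarrow> f y i = f x i)"
    (is "?L \<longleftrightarrow> ?R")
proof
  assume L: ?L
  then have img: "f ` S \<subseteq> T"
    using assms by (auto simp: continuous_map_in_subtopology)
  moreover have "\<exists>n. \<forall>y\<in>S. (\<forall>j<n. y j = x j) \<longrightarrow> f y i = f x i" if x: "x \<in> S" for x i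
  proof -
    let ?V = "{y \<in> T. \<forall>j\<in>{i}. y j = f x j}"
    have "openin (subtopology (full_shift A UNIV) S) {y \<in> topspace (subtopology (full_shift A UNIV) S). f y \<in> ?V}"
      using openin_continuous_map_preimage[OF L openin_cylinder[of "{i}" UNIV T B "f x", OF _ _ assms(2)]] by simp
    moreover have "x \<in> {y \<in> topspace (subtopology (full_shift A UNIV) S). f y \<in> ?V}"
      using x img assms(1) by auto
    ultimately obtain F where F: "finite F"
       "\<And>y. y \<in> S \<Longrightarrow> y \<in> topspace (full_shift A UNIV) \<Longrightarrow> \<forall>i\<in>F. y i = x i \<Longrightarrow> f y \<in> ?V"
      by (elim cylinder_in_open) auto
    obtain n where "F \<subseteq> {..<n}"
      using F(1) finite_nat_iff_bounded by blast
    then show ?thesis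
      using F(2) assms(1) by (intro exI[of _ n]) blast
  qed
  ultimately show ?R by blast
next
  assume R: ?R
  have "continuous_map (subtopology (full_shift A UNIV) S) (discrete_topology B) (\<lambda>x. f x i)" for i
  proof -
    have "openin (subtopology (full_shift A UNIV) S) {x \<in> S. f x i \<in> U}" for U
    proof (subst openin_subopen, intro ballI)
      fix x assume "x \<in> {x \<in> S. f x i \<in> U}"
      then obtain n where "x \<in> S" "f x i \<in> U" "\<forall>y\<in>S. (\<forall>j<n. y j = x j) \<longrightarrow> f y i \<in> U"
        using R by (metis (mono_tags, lifting) mem_Collect_eq)
      then show "\<exists>V. openin (subtopology (full_shift A UNIV) S) V \<and> x \<in> V \<and> V \<subseteq> {x \<in> S. f x i \<in> U}"
        using openin_cylinder[of "{..<n}" UNIV S A x, OF _ _ assms(1)]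
        by (intro exI[of _ "{y \<in> S. \<forall>j\<in>{..<n}. y j = x j}"] conjI) (blast, blast, fastforce)
    qed
    moreover have "topspace (subtopology (full_shift A UNIV) S) = S"
      using assms(1) by auto
    moreover have "f x i \<in> B" if "x \<in> S" for x
      using R assms(2) that by fastforce
    ultimately show ?thesis
      by (auto simp: continuous_map_def)
  qed
  then show ?L
    using R assms
    by (auto simp: continuous_map_in_subtopology full_shift_def continuous_map_componentwise_UNIV)
qed

section \<open>Shifts of periodic points\<close>

lemma funpow_shift: "(shift ^^ n) x = (\<lambda>i. x (i + of_nat n))"
  for x :: "'i::semiring_1 \<Rightarrow> 'a"
  by (induction n) (auto simp: shift_def add_ac)

lemma periodic_iff: "periodic x \<longleftrightarrow> (\<exists>n>0. \<forall>i. x (i + of_nat n) = x i)"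
  for x :: "'i::semiring_1 \<Rightarrow> 'a"
  by (simp add: periodic_def funpow_shift fun_eq_iff)

lemma periodic_add_mult:
  fixes x :: "nat \<Rightarrow> 'a"
  assumes "\<And>i. x (i + n) = x i"
  shows "x (i + n * k) = x i"
proof (induction k)
  case (Suc k)
  then show ?case using assms[of "i + n * k"] by (simp add: algebra_simps)
qed simp

lemma periodic_tail: "periodic x \<Longrightarrow> periodic (\<lambda>i. x (i + k))" for x :: "nat \<Rightarrow> 'a"
  unfolding periodic_iff by (metis add.assoc add.commute of_nat_id)

text \<open>A period \<open>r\<close> of \<open>z\<close> carries \<open>i\<close> forward by
  \<open>r * (n * k)\<close> into the tail, where \<open>z\<close> reads \<open>x\<close> at a
  position congruent to \<open>i\<close> modulo \<open>n\<close>. Used contrapositively: a point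
  that ends in \<open>x\<close> in phase but differs from it somewhere is aperiodic.\<close>

lemma eq_if_periodic_tail:
  fixes z x :: "nat \<Rightarrow> 'a"
  assumes "periodic z" "\<And>i. x (i + n) = x i" "\<And>i. z (i + n * k) = x i"
  shows "z = x"
proof
  fix i
  obtain r where r: "r > 0" "\<And>i. z (i + r) = z i"
    using assms(1) by (auto simp: periodic_iff)
  have "z i = z (i + r * (n * k))"
    using periodic_add_mult[of z, OF r(2)] by simp
  also have "i + r * (n * k) = i + n * (k * (r - 1)) + n * k"
    using r(1) by (cases r) (auto simp: algebra_simps)
  also have "z \<dots> = x i"
    unfolding assms(3) using periodic_add_mult[of x, OF assms(2)] by simp
  finally show "z i = x i" .
qed

section \<open>Invariance of subshifts under translation\<close>

lemma subshift_subset: "subshift A Z \<Longrightarrow> Z \<subseteq> topspace (full_shift A UNIV)"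
  unfolding subshift_def using closedin_subset by blast

lemma subshift_shift: "subshift A Z \<Longrightarrow> z \<in> Z \<Longrightarrow> shift z \<in> Z"
  unfolding subshift_def by blast

lemma subshift_funpow_shift: "subshift A Z \<Longrightarrow> z \<in> Z \<Longrightarrow> (shift ^^ n) z \<in> Z"
  by (induction n) (auto intro: subshift_shift)

text \<open>Negative translates come from surjectivity of the shift on \<open>Z\<close>: an iterated
  preimage of a two-sided point can only be its translate.\<close>

lemma subshift_translate:
  fixes Z :: "(int \<Rightarrow> 'a) set"
  assumes Z: "subshift A Z" and z: "z \<in> Z"
  shows "(\<lambda>i. z (i + k)) \<in> Z"
proof (cases "k \<ge> 0")
  case True
  then show ?thesis
    using subshift_funpow_shift[OF Z z, of "nat k"] by (simp add: funpow_shift)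
next
  case False
  have "\<exists>w\<in>Z. (shift ^^ n) w = z" for n
  proof (induction n)
    case (Suc n)
    then obtain w where w: "w \<in> Z" "(shift ^^ n) w = z" by blast
    then obtain w' where "w' \<in> Z" "shift w' = w"
      using Z unfolding subshift_def by (metis imageE)
    with w show ?case by (intro bexI[of _ w']) (simp_all add: funpow_Suc_right del: funpow.simps)
  qed (use z in auto)
  then obtain w where "w \<in> Z" "(shift ^^ nat (- k)) w = z" by blast
  moreover from this(2) have "(\<lambda>i. z (i + k)) = w"
    using False by (auto simp: funpow_shift)
  ultimately show ?thesis by simp
qed

section \<open>Gluing at periodic points\<close>

locale sync_subshift =
  fixes A :: "'a set" and Z :: "(int \<Rightarrow> 'a) set"
  assumes subshift: "subshift A Z"
    and sync: "\<And>s. s \<in> Z \<Longrightarrow> periodic s \<Longrightarrow> synchronizing_point Z s"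
    and left: "\<not> (\<exists>x\<in>left_part Z. left_periodic x \<and> isolated_point (full_shift A {..0}) (left_part Z) x)"
    and right: "\<not> (\<exists>x\<in>right_part Z. periodic x \<and> isolated_point (full_shift A UNIV) (right_part Z) x)"
begin

abbreviation X :: "(nat \<Rightarrow> 'a) set" where "X \<equiv> right_part Z"

lemma X_subset: "X \<subseteq> topspace (full_shift A UNIV)"
  using subshift_subset[OF subshift] by (force simp: right_part_def)

lemma left_part_subset: "left_part Z \<subseteq> topspace (full_shift A {..0})"
proof
  fix y assume "y \<in> left_part Z"
  then obtain z where "y \<in> extensional {..0}" "z \<in> Z" "\<forall>i\<in>{..0}. y i = z i"
    by (auto simp: left_part_def)
  then show "y \<in> topspace (full_shift A {..0})"
    using subshift_subset[OF subshift] by (fastforce simp: PiE_iff)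
qed

lemma X_tail: "x \<in> X \<Longrightarrow> (\<lambda>i. x (i + k)) \<in> X"
proof -
  assume "x \<in> X"
  then obtain z where "z \<in> Z" "\<forall>i. x i = z (int i)"
    by (auto simp: right_part_def)
  then show ?thesis
    using subshift_translate[OF subshift, of z "int k"]
    by (auto simp: right_part_def intro!: bexI[of _ "\<lambda>i. z (i + int k)"])
qed

lemma X_shift: "x \<in> X \<Longrightarrow> shift x \<in> X"
  using X_tail[of x 1] by (simp add: shift_def)

text \<open>Every finite window of the two-sided periodic sequence already occurs in
  \<open>x\<close> far enough to the right. Translates of an extension \<open>z\<close> of
  \<open>x\<close> therefore approximate it, and \<open>Z\<close> is closed.\<close>

lemma biinfinite_extension:
  assumes x: "x \<in> X" and n: "n > 0" "\<And>i. x (i + n) = x i"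
  shows "(\<lambda>i. x (nat (i mod int n))) \<in> Z"
proof (rule closedin_full_shiftD)
  show "closedin (full_shift A UNIV) Z"
    using subshift by (simp add: subshift_def)
  show "(\<lambda>i. x (nat (i mod int n))) \<in> topspace (full_shift A UNIV)"
    using X_subset x by auto
  fix F :: "int set" assume F: "finite F"
  obtain m where m: "\<forall>i\<in>F. \<bar>i\<bar> \<le> m"
    using F by (metis abs_ge_self finite_imageI Max_ge image_eqI)
  obtain z where z: "z \<in> Z" "\<And>i. x i = z (int i)"
    using x by (auto simp: right_part_def)
  \<comment> \<open>A multiple of \<open>n\<close>, which preserves the phase, and large enough to
    move all of \<open>F\<close> to nonnegative indices.\<close>
  let ?k = "int n * \<bar>m\<bar>"
  have "z (i + ?k) = x (nat (i mod int n))" if "i \<in> F" for i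
  proof -
    have "\<bar>m\<bar> \<le> ?k"
      using n(1) mult_right_mono[of 1 "int n" "\<bar>m\<bar>"] by simp
    then have nn: "i + ?k \<ge> 0"
      using m that by fastforce
    define j where "j = nat (i + ?k)"
    have j: "int j = i + ?k" using nn by (simp add: j_def)
    have "i mod int n = int j mod int n" by (simp add: j)
    then have "nat (i mod int n) = j mod n"
      by (metis nat_int zmod_int)
    moreover have "x j = x (j mod n)"
      using periodic_add_mult[of x n "j mod n" "j div n", OF n(2)] by simp
    ultimately show ?thesis using z(2)[of j] j by simp
  qed
  then show "\<exists>z\<in>Z. \<forall>i\<in>F. z i = x (nat (i mod int n))"
    using subshift_translate[OF subshift z(1), of ?k] by (intro bexI[of _ "\<lambda>i. z (i + ?k)"]) auto
qed

text \<open>The splicing property of a synchronizing word, for the word formed by the first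
  \<open>K\<close> letters of \<open>x\<close>. The half-open window starting at \<open>t\<close>
  avoids carrying a word and its endpoints around.\<close>

definition sync_prefix :: "(nat \<Rightarrow> 'a) \<Rightarrow> nat \<Rightarrow> bool" where
  "sync_prefix x K \<longleftrightarrow> (\<forall>a\<in>Z. \<forall>b\<in>Z. \<forall>t. (\<forall>i<K. a (t + int i) = x i) \<longrightarrow> (\<forall>i<K. b (t + int i) = x i) \<longrightarrow>
    (\<lambda>i. if i < t + int K then a i else b i) \<in> Z)"

lemma sync_prefixD:
  assumes "sync_prefix x K" "a \<in> Z" "b \<in> Z"
    and "\<And>i. i < K \<Longrightarrow> a (t + int i) = x i" "\<And>i. i < K \<Longrightarrow> b (t + int i) = x i"
  shows "(\<lambda>i. if i < t + int K then a i else b i) \<in> Z"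
  using assms unfolding sync_prefix_def by blast

text \<open>The periodic two-sided extension \<open>s\<close> of \<open>x\<close> contains a
  synchronizing word \<open>w\<close>. Moved right by a multiple of the period, \<open>w\<close>
  becomes the end of a prefix of \<open>x\<close>, so agreeing with that prefix forces an occurrence
  of \<open>w\<close>.\<close>

lemma sync_prefix_exists:
  assumes x: "x \<in> X" "periodic x"
  obtains K where "sync_prefix x K"
proof -
  obtain n where n: "n > 0" "\<And>i. x (i + n) = x i"
    using x(2) by (auto simp: periodic_iff)
  define s where "s = (\<lambda>i. x (nat (i mod int n)))"
  have s: "s \<in> Z" unfolding s_def by (rule biinfinite_extension[of x n, OF x(1) n])
  have sx: "s (int i) = x i" for i
    using periodic_add_mult[of x n "i mod n" "i div n", OF n(2)]
    by (simp add: s_def flip: zmod_int)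
  have speriod: "s (i + int n * k) = s i" for i k
    by (simp add: s_def)
  have "periodic s"
    using n(1) speriod[of _ 1] by (auto simp: periodic_iff)
  then obtain w l l' where w: "synchronizing_word Z w" "subword s l l' = w"
    using sync[OF s] by (auto simp: synchronizing_point_def occurs_in_def)
  define m where "m = int n * (\<bar>l\<bar> + \<bar>l'\<bar>)"
  have "\<bar>l\<bar> + \<bar>l'\<bar> \<le> m"
    unfolding m_def using n(1) mult_right_mono[of 1 "int n" "\<bar>l\<bar> + \<bar>l'\<bar>"] by simp
  then have m: "l + m \<ge> 0" "l' + m \<ge> 0" by auto
  \<comment> \<open>One past the last letter of the moved \<open>w\<close>, so that the cut after
    \<open>w\<close> is exactly the cut at \<open>t + int K\<close>.\<close>
  define K where "K = nat (l' + m + 1)"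
  have K: "int K = l' + m + 1" using m(2) by (simp add: K_def)
  have occ: "subword a (t + m + l) (t + m + l') = w" if "\<forall>i<K. a (t + int i) = x i" for a t
  proof -
    have "a (t + m + i) = s i" if i: "l \<le> i" "i \<le> l'" for i
    proof -
      define j where "j = nat (m + i)"
      have j: "int j = m + i" using i m(1) by (simp add: j_def)
      then have "j < K" using K i by linarith
      then have "a (t + int j) = x j"
        using \<open>\<forall>i<K. a (t + int i) = x i\<close> by blast
      also have "x j = s i"
        using speriod[of i "\<bar>l\<bar> + \<bar>l'\<bar>"] by (simp add: j m_def add.commute flip: sx)
      finally show ?thesis by (simp add: j add.assoc)
    qed
    from this[of "l + int i" for i] show ?thesis
      unfolding subword_def w(2)[symmetric] by (auto intro!: nth_equalityI simp: add.assoc)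
  qed
  show thesis
  proof (rule that[of K])
    have "(\<lambda>i. if i < t + int K then a i else b i) \<in> Z"
      if ab: "a \<in> Z" "b \<in> Z" "\<forall>i<K. a (t + int i) = x i" "\<forall>i<K. b (t + int i) = x i" for a b t
    proof -
      have "(\<lambda>i. if i \<le> t + m + l' then a i else b i) \<in> Z"
        using w(1) ab(1,2) occ[OF ab(3)] occ[OF ab(4)] unfolding synchronizing_word_def by blast
      moreover have "i \<le> t + m + l' \<longleftrightarrow> i < t + int K" for i
        using K by linarith
      ultimately show ?thesis by simp
    qed
    then show "sync_prefix x K" by (simp add: sync_prefix_def)
  qed
qed

lemma one_sided_gluing:
  assumes K: "sync_prefix x K" and pq: "p \<in> X" "q \<in> X"
    and px: "\<And>i. i < K \<Longrightarrow> p (t + i) = x i" and qx: "\<And>i. i < K \<Longrightarrow> q i = x i"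
  shows "(\<lambda>i. if i < t then p i else q (i - t)) \<in> X"
proof -
  obtain a where a: "a \<in> Z" "\<And>i. p i = a (int i)"
    using pq(1) by (auto simp: right_part_def)
  obtain b where b: "b \<in> Z" "\<And>i. q i = b (int i)"
    using pq(2) by (auto simp: right_part_def)
  \<comment> \<open>Synchronization places the cut at the end of the common window. There
    \<open>p\<close> and the translate of \<open>q\<close> both read \<open>x\<close>, so cutting at
    \<open>t\<close> instead gives the same right half.\<close>
  define c where "c = (\<lambda>i. if i < int t + int K then a i else b (i + - int t))"
  have "c \<in> Z"
    unfolding c_def using px qx by (intro sync_prefixD[OF K a(1) subshift_translate[OF subshift b(1)]])
      (simp_all add: a(2) b(2))
  moreover have "(if i < t then p i else q (i - t)) = c (int i)" for i
  proof (cases "t \<le> i \<and> i < t + K")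
    case True
    then show ?thesis
      using px[of "i - t"] qx[of "i - t"] a(2)[of i] by (auto simp: c_def)
  next
    case False
    then show ?thesis using a(2) b(2)[of "i - t"] by (auto simp: c_def of_nat_diff)
  qed
  ultimately show ?thesis
    by (auto simp: right_part_def)
qed

section \<open>Aperiodic points near periodic ones and in front of them\<close>

text \<open>Since \<open>x\<close> is not isolated, some \<open>y \<noteq> x\<close> is close to it.
  If \<open>y\<close> is periodic too, following \<open>y\<close> past a difference and then
  switching to \<open>x\<close> yields an aperiodic point.\<close>

lemma aperiodic_near_periodic:
  assumes x: "x \<in> X" "periodic x"
  obtains y where "y \<in> aperiodic_part X" "\<forall>i<N. y i = x i"
proof -
  obtain n where n: "n > 0" "\<And>i. x (i + n) = x i"
    using x(2) by (auto simp: periodic_iff)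
  obtain K where K: "sync_prefix x K"
    using sync_prefix_exists[OF x] by blast
  obtain y where y: "y \<in> X" "y \<noteq> x" "\<forall>i\<in>{..<N + K}. y i = x i"
    using right x not_isolated_point_imp[OF _ x(1) X_subset, of "{..<N + K}"] by blast
  show thesis
  proof (cases "periodic y")
    case False
    then show thesis using y by (intro that[of y]) (auto simp: aperiodic_part_def)
  next
    case True
    then obtain q where q: "q > 0" "\<And>i. y (i + q) = y i"
      by (auto simp: periodic_iff)
    obtain d where d: "y d \<noteq> x d" using y(2) by auto
    \<comment> \<open>A multiple of \<open>q\<close>, so \<open>y\<close> repeats its prefix at
      \<open>t\<close> and can be spliced there; a multiple of \<open>n\<close>, so the tail
      \<open>x\<close> starts in phase; and beyond both the difference \<open>d\<close> and the
      prefix length \<open>N\<close>.\<close>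
    define t where "t = n * (q * (d + N + 1))"
    have "d + N + 1 \<le> t"
      using mult_le_mono1[of 1 "n * q" "d + N + 1"] n(1) q(1)
      by (simp add: t_def Suc_le_eq distrib_left mult.assoc)
    then have t: "d < t" "N \<le> t" by auto
    let ?z = "\<lambda>i. if i < t then y i else x (i - t)"
    have "y (t + i) = x i" if "i < K" for i
      using periodic_add_mult[of y q i "n * (d + N + 1)", OF q(2)] y(3) that
      by (simp add: t_def algebra_simps)
    then have "?z \<in> X"
      using y(3) by (intro one_sided_gluing[OF K y(1) x(1)]) auto
    moreover have "\<not> periodic ?z"
    proof
      assume "periodic ?z"
      then have "?z = x"
        by (rule eq_if_periodic_tail[where k = "q * (d + N + 1)" and n = n and x = x, OF _ n(2)]) (simp add: t_def)
      then have "?z d = x d" by (rule fun_cong)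
      then show False using d t(1) by simp
    qed
    ultimately show thesis
      using y(3) t(2) by (intro that[of ?z]) (simp_all add: aperiodic_part_def)
  qed
qed

text \<open>A periodic tail of \<open>x\<close> is replaced by a nearby aperiodic point, glued at
  \<open>t\<close>. For equivariance, \<open>t = 1\<close> supplies approximations whose shift is
  aperiodic as well.\<close>

lemma aperiodic_tail_dense:
  assumes x: "x \<in> X"
  obtains y where "y \<in> X" "(\<lambda>i. y (i + t)) \<in> aperiodic_part X" "\<forall>i<N. y i = x i"
proof (cases "periodic (\<lambda>i. x (i + t))")
  case False
  then show thesis
    using x X_tail[OF x] by (intro that[of x]) (auto simp: aperiodic_part_def)
next
  case True
  let ?x = "\<lambda>i. x (i + t)"
  obtain K where K: "sync_prefix ?x K"
    using sync_prefix_exists[OF X_tail[OF x] True] by blast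
  obtain q where q: "q \<in> aperiodic_part X" "\<forall>i<N + K. q i = ?x i"
    using aperiodic_near_periodic[OF X_tail[OF x] True] by metis
  let ?y = "\<lambda>i. if i < t then x i else q (i - t)"
  have "?y \<in> X"
    using x q by (intro one_sided_gluing[OF K]) (auto simp: aperiodic_part_def add.commute)
  then show thesis
    using q by (intro that[of ?y]) auto
qed

lemma aperiodic_dense:
  assumes "x \<in> X"
  obtains y where "y \<in> aperiodic_part X" "\<forall>i<N. y i = x i"
proof (rule aperiodic_tail_dense[OF assms, of 0 N])
  fix y assume "(\<lambda>i. y (i + 0)) \<in> aperiodic_part X" "\<forall>i<N. y i = x i"
  then show thesis by (intro that[of y]) simp_all
qed

text \<open>The left half of the periodic extension \<open>s\<close> is not isolated, so some left
  past agrees with it near 0 but differs further out. Splicing this past to the future of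
  \<open>s\<close> and starting to read before the difference gives \<open>p\<close>.\<close>

lemma aperiodic_preimage_of_periodic:
  assumes x: "x \<in> X" "periodic x"
  obtains p t where "p \<in> aperiodic_part X" "\<And>i. p (i + t) = x i"
proof -
  obtain n where n: "n > 0" "\<And>i. x (i + n) = x i"
    using x(2) by (auto simp: periodic_iff)
  obtain K where K: "sync_prefix x K"
    using sync_prefix_exists[OF x] by blast
  define s where "s = (\<lambda>i. x (nat (i mod int n)))"
  have s: "s \<in> Z" unfolding s_def by (rule biinfinite_extension[of x n, OF x(1) n])
  have sx: "s (int i) = x i" for i
    using periodic_add_mult[of x n "i mod n" "i div n", OF n(2)]
    by (simp add: s_def flip: zmod_int)
  have speriod: "s (i + int n * k) = s i" for i k
    by (simp add: s_def)
  \<comment> \<open>As a multiple of \<open>n\<close>, \<open>-?m\<close> is a place where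
    \<open>s\<close> begins to read \<open>x\<close>; as \<open>?m\<close> is at least
    \<open>K\<close>, the synchronizing window starting there ends before index 0.\<close>
  let ?s = "restrict s {..0}" and ?m = "int n * int K"
  have "?s \<in> left_part Z"
    using s by (auto simp: left_part_def)
  moreover have "left_periodic ?s"
    using n(1) speriod[of _ "-1"] by (auto simp: left_periodic_def intro!: exI[of _ n])
  ultimately obtain y where y: "y \<in> left_part Z" "y \<noteq> ?s" "\<forall>i\<in>{-?m..0}. y i = ?s i"
    using left not_isolated_point_imp[OF _ _ left_part_subset, of ?s "{-?m..0}"] by auto
  obtain z where z: "z \<in> Z" "\<forall>i\<in>{..0}. y i = z i" "y \<in> extensional {..0}"
    using y(1) by (auto simp: left_part_def)
  have "\<exists>e\<le>0. y e \<noteq> ?s e"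
    using y(2) z(3) by (metis atMost_iff extensionalityI restrict_extensional)
  then obtain e where e: "e \<le> 0" "z e \<noteq> s e"
    using z(2) by auto
  have zs: "z i = s i" if "-?m \<le> i" "i \<le> 0" for i
    using y(3) z(2) that by auto
  have e': "e < -?m" using zs[of e] e by force
  have mK: "int K \<le> ?m" using n(1) mult_right_mono[of 1 "int n" "int K"] by simp
  define a where "a = (\<lambda>i. if i < -?m + int K then z i else s i)"
  have sK: "s (-?m + int i) = x i" for i
    using speriod[of "int i" "- int K"] sx[of i] by (simp add: algebra_simps)
  have zK: "z (-?m + int i) = x i" if "i < K" for i
  proof -
    have "-?m \<le> -?m + int i" "-?m + int i \<le> 0" using mK that by linarith+
    then show ?thesis using zs sK by metis
  qed
  have "a \<in> Z"
    unfolding a_def using sK zK by (intro sync_prefixD[OF K z(1) s]) auto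
  have as: "a i = s i" if "i \<ge> 0" for i
    using that mK by (simp add: a_def)
  have ae: "a e \<noteq> s e" using e(2) e' by (simp add: a_def)
  define k where "k = nat (- e)"
  have k: "int k = - e" using e(1) by (simp add: k_def)
  \<comment> \<open>Reading starts at \<open>- int (n * k)\<close>, which is at most
    \<open>e = - int k\<close> since \<open>n > 0\<close>, and in phase with the period.\<close>
  define p where "p = (\<lambda>i. a (int i + - int (n * k)))"
  have "p \<in> X"
    using subshift_translate[OF subshift \<open>a \<in> Z\<close>, of "- int (n * k)"]
    by (auto simp: right_part_def p_def)
  have tail: "p (i + n * k) = x i" for i
    using as[of "int i"] sx by (simp add: p_def)
  have "\<not> periodic p"
  proof
    assume "periodic p"
    then have "p = x" by (rule eq_if_periodic_tail[where n = n and x = x, OF _ n(2) tail])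
    \<comment> \<open>Index \<open>n * k - k\<close> of \<open>p\<close> is coordinate
      \<open>e\<close> of \<open>a\<close>, where \<open>a\<close> and \<open>s\<close>
      differ.\<close>
    have "k \<le> n * k" using n(1) by simp
    then have "p (n * k - k) = a e" "x (n * k - k) = s (e + int n * int k)"
      by (simp_all add: p_def of_nat_diff k flip: sx)
    with \<open>p = x\<close> ae speriod show False by metis
  qed
  with \<open>p \<in> X\<close> show thesis
    by (intro that[OF _ tail]) (simp add: aperiodic_part_def)
qed

section \<open>Limits of the partial map at periodic points\<close>

text \<open>Periodicity passes to tails, so an aperiodic tail makes \<open>q\<close> and all
  intermediate shifts aperiodic. The partial equivariance of \<open>f\<close> thus applies at every
  step of the induction.\<close>

lemma shift_commuting_tail:
  assumes f: "shift_commuting_on (aperiodic_part X) f" and q: "q \<in> X"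
    and tail: "(\<lambda>i. q (i + t)) \<in> aperiodic_part X"
  shows "f q (i + t) = f (\<lambda>i. q (i + t)) i"
  using q tail
proof (induction t arbitrary: q)
  case (Suc t)
  have *: "(\<lambda>i. shift q (i + t)) = (\<lambda>i. q (i + Suc t))"
    by (simp add: shift_def)
  have "\<not> periodic (shift q)" "\<not> periodic q"
    using periodic_tail[of "shift q" t] periodic_tail[of q "Suc t"] Suc.prems(2)
    by (auto simp: aperiodic_part_def *)
  then have "shift (f q) = f (shift q)"
    using f Suc.prems(1) X_shift[OF Suc.prems(1)]
    by (auto simp: shift_commuting_on_def aperiodic_part_def)
  then have "f q (i + Suc t) = f (shift q) (i + t)"
    by (simp add: shift_def fun_eq_iff)
  also have "\<dots> = f (\<lambda>i. q (i + Suc t)) i"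
    using Suc.IH[OF X_shift[OF Suc.prems(1)]] Suc.prems(2) unfolding * by blast
  finally show ?case .
qed simp

text \<open>\<open>L\<close> is the value that a continuous extension of \<open>f\<close> must take
  at \<open>x\<close>. Aperiodic points are included, with \<open>L = f x\<close>, so that the
  extension can be chosen uniformly on \<open>X\<close>.\<close>

lemma limit_exists:
  assumes B: "subshift B Y"
    and cont: "continuous_map (subtopology (full_shift A UNIV) (aperiodic_part X))
           (subtopology (full_shift B UNIV) (aperiodic_part Y)) f"
    and f: "shift_commuting_on (aperiodic_part X) f"
    and x: "x \<in> X"
  shows "\<exists>L\<in>Y. \<forall>i. \<exists>n. \<forall>y\<in>aperiodic_part X. (\<forall>j<n. y j = x j) \<longrightarrow> f y i = L i"
proof -
  have "aperiodic_part X \<subseteq> topspace (full_shift A UNIV)" "aperiodic_part Y \<subseteq> topspace (full_shift B UNIV)"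
    using X_subset subshift_subset[OF B] by (auto simp: aperiodic_part_def)
  then have img: "f ` aperiodic_part X \<subseteq> aperiodic_part Y"
    and cont': "\<And>x i. x \<in> aperiodic_part X \<Longrightarrow>
      \<exists>n. \<forall>y\<in>aperiodic_part X. (\<forall>j<n. y j = x j) \<longrightarrow> f y i = f x i"
    using cont by (simp_all add: continuous_map_full_shift_iff del: topspace_full_shift)
  show ?thesis
  proof (cases "periodic x")
    case False
    then have "x \<in> aperiodic_part X" using x by (simp add: aperiodic_part_def)
    with img cont' show ?thesis
      by (intro bexI[of _ "f x"]) (auto simp: aperiodic_part_def)
  next
    case True
    obtain K where K: "sync_prefix x K"
    using sync_prefix_exists[OF x True] by blast
    obtain p t where p: "p \<in> aperiodic_part X" "\<And>i. p (i + t) = x i"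
      using aperiodic_preimage_of_periodic[OF x True] by metis
    have "f p \<in> Y" using p(1) img by (auto simp: aperiodic_part_def)
    then have L: "(\<lambda>i. f p (i + t)) \<in> Y"
      using subshift_funpow_shift[OF B, of "f p" t] by (simp add: funpow_shift)
    moreover have "\<exists>n. \<forall>y\<in>aperiodic_part X. (\<forall>j<n. y j = x j) \<longrightarrow> f y i = f p (i + t)" for i
    proof -
      obtain m where m: "\<And>y. y \<in> aperiodic_part X \<Longrightarrow> \<forall>j<m. y j = p j \<Longrightarrow> f y (i + t) = f p (i + t)"
        using cont'[OF p(1)] by metis
      \<comment> \<open>The first \<open>K\<close> letters permit gluing \<open>y\<close> behind the
        first \<open>t\<close> letters of \<open>p\<close>; the further \<open>m\<close> ensure that
        the result agrees with \<open>p\<close> on \<open>m\<close> letters.\<close>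
      have "f y i = f p (i + t)" if y: "y \<in> aperiodic_part X" "\<forall>j<m + K. y j = x j" for y
      proof -
        let ?q = "\<lambda>i. if i < t then p i else y (i - t)"
        have tail: "(\<lambda>i. ?q (i + t)) = y" by simp
        have q: "?q \<in> X"
          using p y by (intro one_sided_gluing[OF K]) (auto simp: aperiodic_part_def add.commute)
        moreover have "\<not> periodic ?q"
          using periodic_tail[of ?q t] y(1) unfolding tail by (auto simp: aperiodic_part_def)
        moreover have "?q j = p j" if "j < m" for j
          using y(2) p(2)[of "j - t"] that by auto
        ultimately have "f ?q (i + t) = f p (i + t)"
          by (intro m) (auto simp: aperiodic_part_def)
        then show ?thesis
          using shift_commuting_tail[OF f q, of t i] y(1) unfolding tail by simp
      qed
      then show ?thesis by blast
    qed
    ultimately show ?thesis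
      by (intro bexI[OF _ L]) blast
  qed
qed

end

section \<open>Existence and uniqueness of the extension\<close>

theorem theorem4:
  fixes A :: "'a set" and B :: "'b set"
    and Z :: "(int \<Rightarrow> 'a) set" and X :: "(nat \<Rightarrow> 'a) set" and Y :: "(nat \<Rightarrow> 'b) set"
    and \<phi>' :: "(nat \<Rightarrow> 'a) \<Rightarrow> (nat \<Rightarrow> 'b)"
  assumes "finite A" and "finite B"
    and "subshift A Z"
    and "\<And>s. s \<in> Z \<Longrightarrow> periodic s \<Longrightarrow> synchronizing_point Z s"
    and "\<not> (\<exists>x\<in>left_part Z. left_periodic x \<and> isolated_point (full_shift A {..0}) (left_part Z) x)"
    and "\<not> (\<exists>x\<in>right_part Z. periodic x \<and> isolated_point (full_shift A UNIV) (right_part Z) x)"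
    and "X = right_part Z"
    and "subshift B Y"
    and "continuous_map (subtopology (full_shift A UNIV) (aperiodic_part X))
           (subtopology (full_shift B UNIV) (aperiodic_part Y)) \<phi>'"
    and "shift_commuting_on (aperiodic_part X) \<phi>'"
  shows "\<exists>!\<phi>. \<phi> \<in> extensional X
           \<and> continuous_map (subtopology (full_shift A UNIV) X) (subtopology (full_shift B UNIV) Y) \<phi>
           \<and> (\<forall>x\<in>X. shift (\<phi> x) = \<phi> (shift x))
           \<and> (\<forall>x\<in>aperiodic_part X. \<phi> x = \<phi>' x)"
proof -
  interpret S: sync_subshift A Z
    using assms(3-6) by (rule sync_subshift.intro)
  note XZ = \<open>X = right_part Z\<close>
  note cont_iff = continuous_map_full_shift_iff[OF S.X_subset[folded XZ] subshift_subset[OF \<open>subshift B Y\<close>]]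
  have "\<forall>x\<in>X. \<exists>L. L \<in> Y \<and> (\<forall>i. \<exists>n. \<forall>y\<in>aperiodic_part X. (\<forall>j<n. y j = x j) \<longrightarrow> \<phi>' y i = L i)"
    using S.limit_exists assms(8-10) unfolding XZ by blast
  then obtain L where L: "\<And>x. x \<in> X \<Longrightarrow> L x \<in> Y"
      "\<And>x i. x \<in> X \<Longrightarrow> \<exists>n. \<forall>y\<in>aperiodic_part X. (\<forall>j<n. y j = x j) \<longrightarrow> \<phi>' y i = L x i"
    unfolding bchoice_iff by blast
  \<comment> \<open>An aperiodic \<open>x\<close> is itself among the points \<open>y\<close> in the
    limit property.\<close>
  have L_eq: "L x = \<phi>' x" if "x \<in> aperiodic_part X" for x
  proof
    show "L x i = \<phi>' x i" for i
      using L(2)[of x i] that by (metis (no_types, lifting) aperiodic_part_def mem_Collect_eq)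
  qed
  \<comment> \<open>Functions are total, so uniqueness requires a fixed value outside
    \<open>X\<close>.\<close>
  define \<phi> where "\<phi> = restrict L X"
  show ?thesis
  proof (rule ex1I[of _ \<phi>]; (elim conjE)?)
    have "\<exists>n. \<forall>y\<in>X. (\<forall>j<n. y j = x j) \<longrightarrow> \<phi> y i = \<phi> x i" if x: "x \<in> X" for x i
    proof -
      obtain n where n: "\<And>y. y \<in> aperiodic_part X \<Longrightarrow> \<forall>j<n. y j = x j \<Longrightarrow> \<phi>' y i = L x i"
        using L(2)[OF x] by metis
      have "\<phi> y i = \<phi> x i" if y: "y \<in> X" "\<forall>j<n. y j = x j" for y
      proof -
        obtain m where m: "\<And>w. w \<in> aperiodic_part X \<Longrightarrow> \<forall>j<m. w j = y j \<Longrightarrow> \<phi>' w i = L y i"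
          using L(2)[OF y(1)] by metis
        \<comment> \<open>Such a \<open>w\<close> is close enough to both \<open>x\<close> and
          \<open>y\<close>, so \<open>\<phi>' w i\<close> equals both \<open>L x i\<close> and
          \<open>L y i\<close>.\<close>
        obtain w where "w \<in> aperiodic_part X" "\<forall>j<n + m. w j = y j"
          using S.aperiodic_dense[of y] y(1) unfolding XZ by metis
        with n[of w] m[of w] x y show ?thesis by (simp add: \<phi>_def)
      qed
      then show ?thesis by blast
    qed
    moreover have "\<phi> ` X \<subseteq> Y" using L(1) by (auto simp: \<phi>_def)
    ultimately have "continuous_map (subtopology (full_shift A UNIV) X) (subtopology (full_shift B UNIV) Y) \<phi>"
      unfolding cont_iff by blast
    moreover have "shift (\<phi> x) = \<phi> (shift x)" if x: "x \<in> X" for x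
    proof
      fix i
      have sx: "shift x \<in> X" using x S.X_shift unfolding XZ by blast
      obtain n where n: "\<And>y. y \<in> aperiodic_part X \<Longrightarrow> \<forall>j<n. y j = x j \<Longrightarrow> \<phi>' y (i + 1) = L x (i + 1)"
        using L(2)[OF x] by metis
      obtain m where m: "\<And>y. y \<in> aperiodic_part X \<Longrightarrow> \<forall>j<m. y j = shift x j \<Longrightarrow> \<phi>' y i = L (shift x) i"
        using L(2)[OF sx] by metis
      \<comment> \<open>The extra letter compensates for the one lost by shifting, so
        \<open>y\<close> is close to \<open>x\<close> and its shift is close to
        \<open>shift x\<close>.\<close>
      obtain y where y: "y \<in> X" "(\<lambda>i. y (i + 1)) \<in> aperiodic_part X" "\<forall>j<n + m + 1. y j = x j"
        using S.aperiodic_tail_dense[of x 1] x unfolding XZ by metis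
      have y': "y \<in> aperiodic_part X"
        using periodic_tail[of y 1] y(1,2) by (auto simp: aperiodic_part_def)
      have "\<phi>' y (i + 1) = \<phi>' (\<lambda>i. y (i + 1)) i"
        using S.shift_commuting_tail[of \<phi>' y 1 i] assms(10) y(1,2) unfolding XZ by blast
      moreover have "\<phi>' y (i + 1) = L x (i + 1)"
        by (rule n[OF y']) (use y(3) in simp)
      moreover have "\<phi>' (\<lambda>i. y (i + 1)) i = L (shift x) i"
        by (rule m[OF y(2)]) (use y(3) in \<open>simp add: shift_def\<close>)
      ultimately show "shift (\<phi> x) i = \<phi> (shift x) i"
        using x sx by (simp add: \<phi>_def shift_def[of "L x"])
    qed
    moreover have "\<phi> x = \<phi>' x" if "x \<in> aperiodic_part X" for x
      using L_eq[OF that] that by (simp add: \<phi>_def aperiodic_part_def)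
    ultimately show "\<phi> \<in> extensional X
           \<and> continuous_map (subtopology (full_shift A UNIV) X) (subtopology (full_shift B UNIV) Y) \<phi>
           \<and> (\<forall>x\<in>X. shift (\<phi> x) = \<phi> (shift x))
           \<and> (\<forall>x\<in>aperiodic_part X. \<phi> x = \<phi>' x)"
      by (simp add: \<phi>_def)
  next
    fix \<psi>
    assume \<psi>: "\<psi> \<in> extensional X" "\<forall>x\<in>aperiodic_part X. \<psi> x = \<phi>' x"
      "continuous_map (subtopology (full_shift A UNIV) X) (subtopology (full_shift B UNIV) Y) \<psi>"
    show "\<psi> = \<phi>"
    proof (rule extensionalityI[OF \<psi>(1)])
      show "\<phi> \<in> extensional X" by (simp add: \<phi>_def)
      fix x assume x: "x \<in> X"
      show "\<psi> x = \<phi> x"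
      proof
        fix i
        obtain n where n: "\<And>y. y \<in> X \<Longrightarrow> \<forall>j<n. y j = x j \<Longrightarrow> \<psi> y i = \<psi> x i"
          using \<psi>(3) x unfolding cont_iff by metis
        obtain m where m: "\<And>y. y \<in> aperiodic_part X \<Longrightarrow> \<forall>j<m. y j = x j \<Longrightarrow> \<phi>' y i = L x i"
          using L(2)[OF x] by metis
        \<comment> \<open>At this \<open>y\<close> both maps equal \<open>\<phi>'\<close>, while
          coordinate \<open>i\<close> is already that of \<open>\<psi> x\<close> and of
          \<open>L x\<close>.\<close>
        obtain y where y: "y \<in> aperiodic_part X" "\<forall>j<n + m. y j = x j"
          using S.aperiodic_dense[of x] x unfolding XZ by metis
        then have "y \<in> X" by (simp add: aperiodic_part_def)
        with n[of y] m[of y] y \<psi>(2) x show "\<psi> x i = \<phi> x i" by (simp add: \<phi>_def)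
      qed
    qed
  qed
qed

end
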